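(* Let $M$ be a non-unit sphere, i.e. a $2$-sphere of constant sectional curvature $K\neq 1$, and let $T_1M$ be its unit tangent bundle endowed with the natural diagonal contact metric structure $(\varphi_1,\xi_1,\eta_1,g_1)$ with constants satisfying $c_2=c_1+d_1$. Suppose that $\tilde\gamma(s)=(\gamma(s),X(s))$ is a slant curve in $T_1M$ and that $\gamma$ is a curve with constant velocity $r_0$. Let $\kappa$ be the curvature of $\gamma$ in $M$ and $\tilde\kappa$ the curvature of $\tilde\gamma$ in $(T_1M,g_1)$. Then $\tilde\gamma$ is $\tilde N$-slant if and only if $$\frac{(K-1)\kappa}{\tilde\kappa}$$ is a nonzero constant.
   Context: Natural diagonal structure. Let $(M,g)$ be a Riemannian manifold with Levi-Civita connection $\nabla$, $TM$ its tangent bundle, $X^{h}$ and $X^{v}$ the horizontal (with respect to $\nabla$) and vertical lifts to $TM$ of a vector field $X$ on $M$, and $T_1M=\{u\in TM: g(u,u)=1\}$ the unit tangent bundle. At $u\in T_1M$ the tangential lift of $X$ is $X^{t}=X^{v}-g(X,u)u^{v}$; tangent vectors to $T_1M$ are of the form $X^h+Y^t$. For constants $c_1,c_2,d_1$ with $c_1>0$, $c_2>0$, $c_1+d_1>0$, the metric $g_1^d$ on $T_1M$ is defined by $$g_1^d(X^h,Y^h)=c_1g(X,Y)+d_1g(X,u)g(Y,u),\quad g_1^d(X^h,Y^t)=0,\quad g_1^d(X^t,Y^t)=c_2[g(X,Y)-g(X,u)g(Y,u)].$$ The natural diagonal structure $(\varphi_1,\xi_1,\eta_1,g_1)$ on $T_1M$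 is $$\varphi_1(X^h)=a_1X^t,\quad \varphi_1(X^t)=-a_2X^h+a_2g(X,u)u^h,\quad \xi_1=\tfrac{1}{2\lambda\alpha}u^h,$$ $$\eta_1(X^t)=0,\quad \eta_1(X^h)=2\alpha\lambda g(X,u),\quad g_1=\alpha g_1^d,\quad \alpha=\tfrac{c_1+d_1}{4\lambda^2},$$ where $\lambda\neq 0$ is a scalar and $a_1$, $a_2=1/a_1$ are constants, all constants being such that $(\varphi_1,\xi_1,\eta_1,g_1)$ is a contact metric structure. Curves. Let $\tilde\gamma(s)=(\gamma(s),X(s))$ be a curve in $T_1M$ (with $M$ a surface) parametrized by arc length with respect to $g_1$, with Frenet apparatus $(\tilde T,\tilde N,\tilde B,\tilde\kappa,\tilde\tau)$ with respect to the Levi-Civita connection of $g_1$ (so $\tilde T=\tilde\gamma'$, $\tilde N$ is the principal normal, $\tilde\kappa$ the curvature, assumed nonzero so that the Frenet frame is defined). The curve $\tilde\gamma$ is called Legendre if $g_1(\tilde T,\xi_1)=0$ along it, slant if $g_1(\tilde T,\xi_1)$ is a nonzero constant, $\tilde N$-Legendre if $g_1(\tilde N,\xi_1)=0$ along it, and $\tilde N$-slant if $g_1(\tilde N,\xi_1)$ is a nonzero constant. The velocity of the projected curve $\gamma$ in $M$ is $r=\|\gamma'(s)\|_g$, and $\kappa$ is its (geodesic) curvature in $M$: with $E=\gamma'$ and Frenet frame $(T,N)$ of $\gamma$, $\nabla_E T=r\kappa N$, $\nabla_E N=-r\kappa T$.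
   Formalization: The claim is false as stated and is proved under two added hypotheses: K c_2 ≠ c_1, and γ' is not everywhere parallel to X; without either, a curve γ with κ ≠ 0 can make the ratio a nonzero constant while g_1(Ñ,ξ_1) = 0. *)

theory Defs
  imports "HOL-Analysis.Analysis"
begin

section \<open>Smooth maps, vector fields and the Levi-Civita connection of a submanifold\<close>

text \<open>Smoothness on an open subset of a Euclidean space. The last clause speaks about directional
  derivatives, so that no norm on the space of derivatives is needed.\<close>

primrec Ck_on ::
  "nat \<Rightarrow> 'a::euclidean_space set \<Rightarrow> ('a \<Rightarrow> 'b::euclidean_space) \<Rightarrow> bool" where
  "Ck_on 0 U f \<longleftrightarrow> continuous_on U f"
| "Ck_on (Suc k) U f \<longleftrightarrow>
     (\<exists>f'. (\<forall>x\<in>U. (f has_derivative f' x) (at x)) \<and> (\<forall>v. Ck_on k U (\<lambda>x. f' x v)))"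

definition smooth_on :: "'a::euclidean_space set \<Rightarrow> ('a \<Rightarrow> 'b::euclidean_space) \<Rightarrow> bool" where
  "smooth_on U f \<longleftrightarrow> (\<forall>k. Ck_on k U f)"

text \<open>Below, a closed submanifold \<open>S\<close> of a Euclidean space is given by the point set \<open>S\<close> and its
  tangent spaces \<open>TS p\<close>. Functions, vector fields and tensors on \<open>S\<close> are represented by smooth maps
  defined near \<open>S\<close>. At points of \<open>S\<close>, the derivative of a function in a tangent direction, the
  bracket of two vector fields and the exterior derivative of a 1-form on tangent vectors depend
  only on the restrictions to \<open>S\<close>.\<close>

definition smooth_near :: "'a::euclidean_space set \<Rightarrow> ('a \<Rightarrow> 'b::euclidean_space) \<Rightarrow> bool" where
  "smooth_near S f \<longleftrightarrow> (\<exists>U. open U \<and> S \<subseteq> U \<and> smooth_on U f)"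

definition vector_field ::
  "'a::euclidean_space set \<Rightarrow> ('a \<Rightarrow> 'a set) \<Rightarrow> ('a \<Rightarrow> 'a) \<Rightarrow> bool" where
  "vector_field S TS X \<longleftrightarrow> smooth_near S X \<and> (\<forall>p\<in>S. X p \<in> TS p)"

definition dir_deriv ::
  "('a::euclidean_space \<Rightarrow> 'b::euclidean_space) \<Rightarrow> 'a \<Rightarrow> 'a \<Rightarrow> 'b" where
  "dir_deriv f p v = frechet_derivative f (at p) v"

definition lie_bracket ::
  "('a::euclidean_space \<Rightarrow> 'a) \<Rightarrow> ('a \<Rightarrow> 'a) \<Rightarrow> 'a \<Rightarrow> 'a" where
  "lie_bracket X Y p = dir_deriv Y p (X p) - dir_deriv X p (Y p)"

definition affine_connection ::
  "'a::euclidean_space set \<Rightarrow> ('a \<Rightarrow> 'a set) \<Rightarrow>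
   (('a \<Rightarrow> 'a) \<Rightarrow> ('a \<Rightarrow> 'a) \<Rightarrow> 'a \<Rightarrow> 'a) \<Rightarrow> bool" where
  "affine_connection S TS nabla \<longleftrightarrow>
     (\<forall>X Y. vector_field S TS X \<longrightarrow> vector_field S TS Y \<longrightarrow> vector_field S TS (nabla X Y)) \<and>
     (\<forall>X Y Z. vector_field S TS X \<longrightarrow> vector_field S TS Y \<longrightarrow> vector_field S TS Z \<longrightarrow>
        (\<forall>p\<in>S. nabla (\<lambda>q. X q + Y q) Z p = nabla X Z p + nabla Y Z p \<and>
               nabla Z (\<lambda>q. X q + Y q) p = nabla Z X p + nabla Z Y p)) \<and>
     (\<forall>(f::'a \<Rightarrow> real) X Y. smooth_near S f \<longrightarrow> vector_field S TS X \<longrightarrow> vector_field S TS Y \<longrightarrow>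
        (\<forall>p\<in>S. nabla (\<lambda>q. f q *\<^sub>R X q) Y p = f p *\<^sub>R nabla X Y p \<and>
               nabla X (\<lambda>q. f q *\<^sub>R Y q) p = dir_deriv f p (X p) *\<^sub>R Y p + f p *\<^sub>R nabla X Y p))"

definition levi_civita ::
  "'a::euclidean_space set \<Rightarrow> ('a \<Rightarrow> 'a set) \<Rightarrow> ('a \<Rightarrow> 'a \<Rightarrow> 'a \<Rightarrow> real) \<Rightarrow>
   (('a \<Rightarrow> 'a) \<Rightarrow> ('a \<Rightarrow> 'a) \<Rightarrow> 'a \<Rightarrow> 'a) \<Rightarrow> bool" where
  "levi_civita S TS g nabla \<longleftrightarrow>
     affine_connection S TS nabla \<and>
     (\<forall>X Y. vector_field S TS X \<longrightarrow> vector_field S TS Y \<longrightarrow>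
        (\<forall>p\<in>S. nabla X Y p - nabla Y X p = lie_bracket X Y p)) \<and>
     (\<forall>X Y Z. vector_field S TS X \<longrightarrow> vector_field S TS Y \<longrightarrow> vector_field S TS Z \<longrightarrow>
        (\<forall>p\<in>S. dir_deriv (\<lambda>q. g q (Y q) (Z q)) p (X p)
               = g p (nabla X Y p) (Z p) + g p (Y p) (nabla X Z p)))"

definition velocity :: "(real \<Rightarrow> 'a::euclidean_space) \<Rightarrow> real \<Rightarrow> 'a" where
  "velocity c s = vector_derivative c (at s)"

definition field_along ::
  "('a::euclidean_space \<Rightarrow> 'a set) \<Rightarrow> real set \<Rightarrow> (real \<Rightarrow> 'a) \<Rightarrow> (real \<Rightarrow> 'a) \<Rightarrow> bool" where
  "field_along TS I c V \<longleftrightarrow> smooth_on I V \<and> (\<forall>s\<in>I. V s \<in> TS (c s))"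

text \<open>\<open>D\<close> is the covariant derivative along the curve \<open>c\<close> induced by the connection \<open>nabla\<close>.\<close>

definition induced_covariant_derivative ::
  "'a::euclidean_space set \<Rightarrow> ('a \<Rightarrow> 'a set) \<Rightarrow> (('a \<Rightarrow> 'a) \<Rightarrow> ('a \<Rightarrow> 'a) \<Rightarrow> 'a \<Rightarrow> 'a) \<Rightarrow>
   real set \<Rightarrow> (real \<Rightarrow> 'a) \<Rightarrow> ((real \<Rightarrow> 'a) \<Rightarrow> real \<Rightarrow> 'a) \<Rightarrow> bool" where
  "induced_covariant_derivative S TS nabla I c D \<longleftrightarrow>
     (\<forall>V. field_along TS I c V \<longrightarrow> field_along TS I c (D V)) \<and>
     (\<forall>V W. field_along TS I c V \<longrightarrow> field_along TS I c W \<longrightarrow>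
        (\<forall>s\<in>I. D (\<lambda>t. V t + W t) s = D V s + D W s)) \<and>
     (\<forall>(f::real \<Rightarrow> real) V. smooth_on I f \<longrightarrow> field_along TS I c V \<longrightarrow>
        (\<forall>s\<in>I. D (\<lambda>t. f t *\<^sub>R V t) s = velocity f s *\<^sub>R V s + f s *\<^sub>R D V s)) \<and>
     (\<forall>X Y. vector_field S TS X \<longrightarrow> vector_field S TS Y \<longrightarrow>
        (\<forall>s\<in>I. X (c s) = velocity c s \<longrightarrow> D (\<lambda>t. Y (c t)) s = nabla X Y (c s)))"

text \<open>Curvature and principal normal of a curve of unit speed for \<open>g\<close>, where \<open>D\<close> is the covariant
  derivative along the curve.\<close>

definition frenet_curvature ::
  "('a::euclidean_space \<Rightarrow> 'a \<Rightarrow> 'a \<Rightarrow> real) \<Rightarrow> ((real \<Rightarrow> 'a) \<Rightarrow> real \<Rightarrow> 'a) \<Rightarrow>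
   (real \<Rightarrow> 'a) \<Rightarrow> real \<Rightarrow> real" where
  "frenet_curvature g D c s = sqrt (g (c s) (D (velocity c) s) (D (velocity c) s))"

definition principal_normal ::
  "('a::euclidean_space \<Rightarrow> 'a \<Rightarrow> 'a \<Rightarrow> real) \<Rightarrow> ((real \<Rightarrow> 'a) \<Rightarrow> real \<Rightarrow> 'a) \<Rightarrow>
   (real \<Rightarrow> 'a) \<Rightarrow> real \<Rightarrow> 'a" where
  "principal_normal g D c s = D (velocity c) s /\<^sub>R frenet_curvature g D c s"

definition nonzero_constant_on :: "real set \<Rightarrow> (real \<Rightarrow> real) \<Rightarrow> bool" where
  "nonzero_constant_on I f \<longleftrightarrow> (\<exists>k. k \<noteq> 0 \<and> (\<forall>s\<in>I. f s = k))"


section \<open>Contact metric structures\<close>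

text \<open>The convention is \<open>2 d\<eta>(X, Y) = X (\<eta> Y) - Y (\<eta> X) - \<eta> [X, Y]\<close>, for which the unit tangent
  bundle with \<open>c1 = c2 = 1\<close>, \<open>d1 = 0\<close> carries one quarter of the Sasaki metric.\<close>

definition ext_deriv ::
  "('a::euclidean_space \<Rightarrow> 'a \<Rightarrow> real) \<Rightarrow> ('a \<Rightarrow> 'a) \<Rightarrow> ('a \<Rightarrow> 'a) \<Rightarrow> 'a \<Rightarrow> real" where
  "ext_deriv eta X Y p =
     (dir_deriv (\<lambda>q. eta q (Y q)) p (X p) - dir_deriv (\<lambda>q. eta q (X q)) p (Y p)
       - eta p (lie_bracket X Y p)) / 2"

definition contact_metric_structure ::
  "'a::euclidean_space set \<Rightarrow> ('a \<Rightarrow> 'a set) \<Rightarrow> ('a \<Rightarrow> 'a \<Rightarrow> 'a) \<Rightarrow> ('a \<Rightarrow> 'a) \<Rightarrow>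
   ('a \<Rightarrow> 'a \<Rightarrow> real) \<Rightarrow> ('a \<Rightarrow> 'a \<Rightarrow> 'a \<Rightarrow> real) \<Rightarrow> bool" where
  "contact_metric_structure S TS phi xi eta g \<longleftrightarrow>
     (\<forall>p\<in>S. xi p \<in> TS p \<and> eta p (xi p) = 1 \<and>
        (\<forall>v\<in>TS p. phi p v \<in> TS p \<and> phi p (phi p v) = - v + eta p v *\<^sub>R xi p \<and>
           (\<forall>w\<in>TS p. g p (phi p v) (phi p w) = g p v w - eta p v * eta p w))) \<and>
     (\<forall>X Y. vector_field S TS X \<longrightarrow> vector_field S TS Y \<longrightarrow>
        (\<forall>p\<in>S. ext_deriv eta X Y p = g p (X p) (phi p (Y p))))"


section \<open>The sphere of curvature \<open>K\<close> and its unit tangent bundle\<close>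

text \<open>The 2-sphere of constant curvature \<open>K > 0\<close> is the round sphere of radius \<open>1 / sqrt K\<close> in
  3-space.\<close>

type_synonym R3 = "real^3"

definition sphere_of_curvature :: "real \<Rightarrow> (R3) set" where
  "sphere_of_curvature K = sphere 0 (1 / sqrt K)"

definition sphere_tangent :: "R3 \<Rightarrow> (R3) set" where
  "sphere_tangent x = {y. x \<bullet> y = 0}"

definition tang_proj :: "R3 \<Rightarrow> R3 \<Rightarrow> R3" where
  "tang_proj x w = w - ((x \<bullet> w) / (x \<bullet> x)) *\<^sub>R x"

text \<open>The Levi-Civita derivative along a curve on the sphere: the tangential part of the ordinary
  derivative.\<close>

definition sphere_cov :: "(real \<Rightarrow> R3) \<Rightarrow> (real \<Rightarrow> R3) \<Rightarrow> real \<Rightarrow> R3" where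
  "sphere_cov \<gamma> V s = tang_proj (\<gamma> s) (velocity V s)"

definition speed :: "(real \<Rightarrow> R3) \<Rightarrow> real \<Rightarrow> real" where
  "speed \<gamma> s = norm (velocity \<gamma> s)"

definition unit_tangent :: "(real \<Rightarrow> R3) \<Rightarrow> real \<Rightarrow> R3" where
  "unit_tangent \<gamma> s = velocity \<gamma> s /\<^sub>R speed \<gamma> s"

text \<open>\<open>N\<close> and \<open>\<kappa>\<close> are the normal and the curvature in a Frenet frame of \<open>\<gamma>\<close> on the sphere. Either of
  the two unit normal fields is allowed for \<open>N\<close>, so \<open>\<kappa>\<close> is determined up to a global sign.\<close>

definition sphere_frenet ::
  "real set \<Rightarrow> (real \<Rightarrow> R3) \<Rightarrow> (real \<Rightarrow> R3) \<Rightarrow> (real \<Rightarrow> real) \<Rightarrow> bool" where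
  "sphere_frenet I \<gamma> N \<kappa> \<longleftrightarrow>
     smooth_on I N \<and>
     (\<forall>s\<in>I. N s \<in> sphere_tangent (\<gamma> s) \<and> norm (N s) = 1 \<and> N s \<bullet> unit_tangent \<gamma> s = 0 \<and>
        sphere_cov \<gamma> (unit_tangent \<gamma>) s = (speed \<gamma> s * \<kappa> s) *\<^sub>R N s \<and>
        sphere_cov \<gamma> N s = - (speed \<gamma> s * \<kappa> s) *\<^sub>R unit_tangent \<gamma> s)"

text \<open>A point of the unit tangent bundle is a pair \<open>(x, u)\<close>; its tangent space is obtained by
  differentiating the equations \<open>x \<bullet> x = 1 / K\<close>, \<open>x \<bullet> u = 0\<close>, \<open>u \<bullet> u = 1\<close>.\<close>

definition unit_tangent_bundle :: "real \<Rightarrow> (R3 \<times> R3) set" where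
  "unit_tangent_bundle K =
     {(x, u). x \<in> sphere_of_curvature K \<and> u \<in> sphere_tangent x \<and> u \<bullet> u = 1}"

fun unit_tangent_space :: "R3 \<times> R3 \<Rightarrow> (R3 \<times> R3) set" where
  "unit_tangent_space (x, u) = {(y, w). x \<bullet> y = 0 \<and> y \<bullet> u + x \<bullet> w = 0 \<and> u \<bullet> w = 0}"

text \<open>The horizontal lift of \<open>y\<close> at \<open>(x, u)\<close> is the velocity of a vector field with value \<open>u\<close> that is
  parallel along a curve with velocity \<open>y\<close>; see \<open>hlift_parallel\<close> below.\<close>

fun hlift :: "R3 \<times> R3 \<Rightarrow> R3 \<Rightarrow> R3 \<times> R3" where
  "hlift (x, u) y = (y, - ((y \<bullet> u) / (x \<bullet> x)) *\<^sub>R x)"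

fun vlift :: "R3 \<times> R3 \<Rightarrow> R3 \<Rightarrow> R3 \<times> R3" where
  "vlift (x, u) y = (0, y)"

definition tlift :: "R3 \<times> R3 \<Rightarrow> R3 \<Rightarrow> R3 \<times> R3" where
  "tlift p y = vlift p y - (y \<bullet> snd p) *\<^sub>R vlift p (snd p)"

text \<open>Every tangent vector is \<open>hlift p (hpart p v) + tlift p (tpart p v)\<close>; see
  \<open>lift_decomposition\<close> below. The tensors of the natural diagonal structure are defined through
  these components.\<close>

definition hpart :: "R3 \<times> R3 \<Rightarrow> R3 \<times> R3 \<Rightarrow> R3" where
  "hpart p v = fst v"

definition tpart :: "R3 \<times> R3 \<Rightarrow> R3 \<times> R3 \<Rightarrow> R3" where
  "tpart p v = tang_proj (fst p) (snd v)"

definition g1d ::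
  "real \<Rightarrow> real \<Rightarrow> real \<Rightarrow> R3 \<times> R3 \<Rightarrow> R3 \<times> R3 \<Rightarrow> R3 \<times> R3 \<Rightarrow> real" where
  "g1d c1 c2 d1 p v w =
     c1 * (hpart p v \<bullet> hpart p w) + d1 * (hpart p v \<bullet> snd p) * (hpart p w \<bullet> snd p)
     + c2 * (tpart p v \<bullet> tpart p w - (tpart p v \<bullet> snd p) * (tpart p w \<bullet> snd p))"

definition nd_alpha :: "real \<Rightarrow> real \<Rightarrow> real \<Rightarrow> real" where
  "nd_alpha c1 d1 l = (c1 + d1) / (4 * l\<^sup>2)"

definition g1 ::
  "real \<Rightarrow> real \<Rightarrow> real \<Rightarrow> real \<Rightarrow>
   R3 \<times> R3 \<Rightarrow> R3 \<times> R3 \<Rightarrow> R3 \<times> R3 \<Rightarrow> real" where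
  "g1 c1 c2 d1 l p v w = nd_alpha c1 d1 l * g1d c1 c2 d1 p v w"

definition phi1 ::
  "real \<Rightarrow> real \<Rightarrow> R3 \<times> R3 \<Rightarrow> R3 \<times> R3 \<Rightarrow> R3 \<times> R3" where
  "phi1 a1 a2 p v =
     a1 *\<^sub>R tlift p (hpart p v)
     + (- a2 *\<^sub>R hlift p (tpart p v) + (a2 * (tpart p v \<bullet> snd p)) *\<^sub>R hlift p (snd p))"

definition xi1 :: "real \<Rightarrow> real \<Rightarrow> real \<Rightarrow> R3 \<times> R3 \<Rightarrow> R3 \<times> R3" where
  "xi1 c1 d1 l p = (1 / (2 * l * nd_alpha c1 d1 l)) *\<^sub>R hlift p (snd p)"

definition eta1 ::
  "real \<Rightarrow> real \<Rightarrow> real \<Rightarrow> R3 \<times> R3 \<Rightarrow> R3 \<times> R3 \<Rightarrow> real" where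
  "eta1 c1 d1 l p v = 2 * nd_alpha c1 d1 l * l * (hpart p v \<bullet> snd p)"


subsection \<open>The defining relations of the lifts and of the natural diagonal structure\<close>

lemma hlift_parallel:
  assumes \<gamma>: "(\<gamma> has_vector_derivative y) (at s)" and U: "(U has_vector_derivative w) (at s)"
    and orth: "\<forall>\<^sub>F t in at s. \<gamma> t \<bullet> U t = 0" "\<gamma> s \<bullet> U s = 0" and nz: "\<gamma> s \<noteq> 0"
    and parallel: "sphere_cov \<gamma> U s = 0"
  shows "((\<lambda>t. (\<gamma> t, U t)) has_vector_derivative hlift (\<gamma> s, U s) y) (at s)"
proof -
  have "((\<lambda>t. \<gamma> t \<bullet> U t) has_vector_derivative (\<gamma> s \<bullet> w + y \<bullet> U s)) (at s)"
    by (rule bounded_bilinear.has_vector_derivative[OF bounded_bilinear_inner \<gamma> U])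
  moreover have "((\<lambda>t. \<gamma> t \<bullet> U t) has_vector_derivative 0) (at s)"
  proof -
    have ev: "\<forall>\<^sub>F t in at s. 0 = \<gamma> t \<bullet> U t"
      using orth(1) by eventually_elim simp
    have "((\<lambda>t. 0) has_derivative (\<lambda>h::real. h *\<^sub>R (0::real))) (at s)"
      by simp
    from has_derivative_transform_eventually[OF this ev] orth(2) show ?thesis
      by (simp add: has_vector_derivative_def)
  qed
  ultimately have eq: "\<gamma> s \<bullet> w = - (y \<bullet> U s)"
    using vector_derivative_unique_at by fastforce
  have "velocity U s = w"
    using U by (simp add: velocity_def vector_derivative_at)
  then have "w = ((\<gamma> s \<bullet> w) / (\<gamma> s \<bullet> \<gamma> s)) *\<^sub>R \<gamma> s"
    using parallel by (simp add: sphere_cov_def tang_proj_def)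
  then have "w = - ((y \<bullet> U s) / (\<gamma> s \<bullet> \<gamma> s)) *\<^sub>R \<gamma> s"
    using eq by simp
  then have "(y, w) = hlift (\<gamma> s, U s) y"
    by simp
  with has_vector_derivative_Pair[OF \<gamma> U] show ?thesis
    by simp
qed

context
  fixes K :: real and x u :: "R3"
  assumes K: "K > 0" and p: "(x, u) \<in> unit_tangent_bundle K"
begin

lemma unit_tangent_bundle_facts: "x \<bullet> x \<noteq> 0" "x \<bullet> u = 0" "u \<bullet> x = 0" "u \<bullet> u = 1"
  using K p
  by (auto simp: unit_tangent_bundle_def sphere_of_curvature_def sphere_tangent_def
      inner_commute)

lemma hpart_tpart_lifts:
  assumes "X \<in> sphere_tangent x"
  shows "hpart (x, u) (hlift (x, u) X) = X" "tpart (x, u) (hlift (x, u) X) = 0"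
    "hpart (x, u) (tlift (x, u) X) = 0" "tpart (x, u) (tlift (x, u) X) = X - (X \<bullet> u) *\<^sub>R u"
  using assms unit_tangent_bundle_facts
  by (auto simp: hpart_def tpart_def tlift_def tang_proj_def sphere_tangent_def inner_diff_right)

lemma lift_decomposition:
  assumes "v \<in> unit_tangent_space (x, u)"
  shows "hpart (x, u) v \<in> sphere_tangent x" "tpart (x, u) v \<in> sphere_tangent x"
    "v = hlift (x, u) (hpart (x, u) v) + tlift (x, u) (tpart (x, u) v)"
proof -
  obtain y w where v: "v = (y, w)" by (cases v)
  have h: "x \<bullet> y = 0" "y \<bullet> u = - (x \<bullet> w)" "u \<bullet> w = 0"
    using assms by (auto simp: v)
  show "hpart (x, u) v \<in> sphere_tangent x" "tpart (x, u) v \<in> sphere_tangent x"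
    "v = hlift (x, u) (hpart (x, u) v) + tlift (x, u) (tpart (x, u) v)"
    using h unit_tangent_bundle_facts
    by (auto simp: v hpart_def tpart_def tlift_def tang_proj_def sphere_tangent_def
        inner_diff_left inner_diff_right inner_commute)
qed

lemma lifts_tangent:
  assumes "X \<in> sphere_tangent x" "Y \<in> sphere_tangent x"
  shows "hlift (x, u) X + tlift (x, u) Y \<in> unit_tangent_space (x, u)"
  using assms unit_tangent_bundle_facts
  by (auto simp: tlift_def sphere_tangent_def inner_diff_left inner_diff_right inner_add_right
      inner_commute)

lemma g1d_lifts:
  assumes "X \<in> sphere_tangent x" "Y \<in> sphere_tangent x"
  shows "g1d c1 c2 d1 (x, u) (hlift (x, u) X) (hlift (x, u) Y)
           = c1 * (X \<bullet> Y) + d1 * (X \<bullet> u) * (Y \<bullet> u)"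
    "g1d c1 c2 d1 (x, u) (hlift (x, u) X) (tlift (x, u) Y) = 0"
    "g1d c1 c2 d1 (x, u) (tlift (x, u) X) (tlift (x, u) Y)
           = c2 * (X \<bullet> Y - (X \<bullet> u) * (Y \<bullet> u))"
  using unit_tangent_bundle_facts
  by (simp_all add: g1d_def hpart_tpart_lifts assms inner_diff_left inner_diff_right
      inner_commute algebra_simps del: hlift.simps)

lemma phi1_lifts:
  assumes "X \<in> sphere_tangent x"
  shows "phi1 a1 a2 (x, u) (hlift (x, u) X) = a1 *\<^sub>R tlift (x, u) X"
    "phi1 a1 a2 (x, u) (tlift (x, u) X)
       = - a2 *\<^sub>R hlift (x, u) X + (a2 * (X \<bullet> u)) *\<^sub>R hlift (x, u) u"
proof -
  have lin: "hlift (x, u) (X - (X \<bullet> u) *\<^sub>R u) = hlift (x, u) X - (X \<bullet> u) *\<^sub>R hlift (x, u) u"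
    by (simp add: inner_diff_left diff_divide_distrib scaleR_left_diff_distrib)
  have h0: "hlift (x, u) 0 = 0" and t0: "tlift (x, u) 0 = 0"
    by (simp_all add: tlift_def prod_eq_iff)
  have n0: "(X - (X \<bullet> u) *\<^sub>R u) \<bullet> u = 0"
    by (simp add: inner_diff_left unit_tangent_bundle_facts(4))
  show "phi1 a1 a2 (x, u) (hlift (x, u) X) = a1 *\<^sub>R tlift (x, u) X"
    unfolding phi1_def hpart_tpart_lifts[OF assms] h0 by (simp del: hlift.simps add: h0)
  show "phi1 a1 a2 (x, u) (tlift (x, u) X)
       = - a2 *\<^sub>R hlift (x, u) X + (a2 * (X \<bullet> u)) *\<^sub>R hlift (x, u) u"
    unfolding phi1_def hpart_tpart_lifts[OF assms] t0 n0 snd_conv lin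
    by (simp add: scaleR_diff_right del: hlift.simps)
qed

lemma eta1_lifts:
  assumes "X \<in> sphere_tangent x"
  shows "eta1 c1 d1 l (x, u) (hlift (x, u) X) = 2 * nd_alpha c1 d1 l * l * (X \<bullet> u)"
    "eta1 c1 d1 l (x, u) (tlift (x, u) X) = 0"
  by (simp_all add: eta1_def hpart_tpart_lifts assms del: hlift.simps)

end

end

theory Submission
  imports Defs
begin

text \<open>
  Near the unit tangent bundle, consider the fields \<open>W\<close> that are combinations with constant
  coefficients \<open>t1, t2, t3\<close> of the horizontal lift of \<open>u\<close>, the horizontal lift of \<open>x \<times> u\<close> and the
  tangential lift of \<open>x \<times> u\<close>. For a slant curve whose projection has constant speed, the slant angle,
  the speed and the arc length condition fix \<open>t1\<close>, \<open>t2\<^sup>2\<close> and \<open>t3\<^sup>2\<close>, so by continuity the curve is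
  an integral curve of one such \<open>W\<close>. Its acceleration is therefore \<open>\<nabla>\<^sub>W W\<close>. All inner products of
  these fields are constant on the bundle, hence the component of \<open>\<nabla>\<^sub>W W\<close> along the geodesic field
  \<open>E\<close> is \<open>- g W [W, E]\<close>, a constant multiple of \<open>t2 t3 (K c2 - c1)\<close>. The curvature of the projection
  satisfies \<open>\<kappa>\<^sup>2 = t3\<^sup>2 / (K r0\<^sup>2)\<close>, so it is constant too. Both functions of the theorem are thus
  constants divided by the curvature of the lifted curve, and each constant vanishes exactly when
  \<open>t3 = 0\<close>.
\<close>

lemma Ck_on_cong:
  assumes "open U" "\<And>x. x \<in> U \<Longrightarrow> f x = g x" "Ck_on k U f"
  shows "Ck_on k U g"
proof (cases k)
  case 0
  with assms show ?thesis
    by (simp cong: continuous_on_cong)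
next
  case (Suc m)
  then obtain f' where f': "\<And>x. x \<in> U \<Longrightarrow> (f has_derivative f' x) (at x)"
    and C: "\<And>v. Ck_on m U (\<lambda>x. f' x v)"
    using assms(3) by auto
  have "(g has_derivative f' x) (at x)" if "x \<in> U" for x
    using has_derivative_transform_within_open[OF f'[OF that] assms(1) that] assms(2) by blast
  with C Suc show ?thesis by auto
qed

lemma smooth_on_cong:
  "open U \<Longrightarrow> (\<And>x. x \<in> U \<Longrightarrow> f x = g x) \<Longrightarrow> smooth_on U f \<Longrightarrow> smooth_on U g"
  unfolding smooth_on_def using Ck_on_cong by blast

lemma smooth_on_has_vector_derivative:
  assumes "smooth_on I c" "s \<in> I"
  shows "(c has_vector_derivative velocity c s) (at s)"
proof -
  have "Ck_on (Suc 0) I c"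
    using assms(1) smooth_on_def by blast
  with assms(2) have "c differentiable at s"
    by (auto simp: differentiable_def)
  then show ?thesis
    by (simp add: velocity_def vector_derivative_works)
qed

lemma smooth_on_velocity:
  assumes "open I" "smooth_on I c"
  shows "smooth_on I (velocity c)"
  unfolding smooth_on_def
proof
  fix k
  have "Ck_on (Suc k) I c"
    using assms(2) smooth_on_def by blast
  then obtain f' where f': "\<And>s. s \<in> I \<Longrightarrow> (c has_derivative f' s) (at s)"
    and C: "Ck_on k I (\<lambda>s. f' s 1)"
    by auto
  have "f' s 1 = velocity c s" if "s \<in> I" for s
    using has_derivative_unique[OF f'[OF that]
        smooth_on_has_vector_derivative[OF assms(2) that, unfolded has_vector_derivative_def]]
    by simp
  with Ck_on_cong[OF assms(1) _ C] show "Ck_on k I (velocity c)" by blast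
qed

lemma smooth_on_continuous: "smooth_on U f \<Longrightarrow> continuous_on U f"
  unfolding smooth_on_def by (metis Ck_on.simps(1))

lemma Ck_on_const: "Ck_on k U (\<lambda>x. a)"
  by (induction k arbitrary: a) (auto intro!: exI[of _ "\<lambda>_ _. 0"])

lemma Ck_on_affine:
  assumes "bounded_linear L"
  shows "Ck_on k U (\<lambda>x. a + L x)"
proof (cases k)
  case 0
  then show ?thesis
    using continuous_on_add[OF continuous_on_const linear_continuous_on[OF assms]] by simp
next
  case (Suc m)
  have "((\<lambda>x. a + L x) has_derivative L) (at x)" for x
    using has_derivative_add[OF has_derivative_const bounded_linear_imp_has_derivative[OF assms]]
    by simp
  then show ?thesis
    unfolding Suc by (auto intro!: exI[of _ "\<lambda>_. L"] Ck_on_const)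
qed

lemma constant_if_square_constant:
  fixes f :: "real \<Rightarrow> real"
  assumes "is_interval I" "continuous_on I f" "\<And>s. s \<in> I \<Longrightarrow> (f s)\<^sup>2 = k"
  obtains b where "\<And>s. s \<in> I \<Longrightarrow> f s = b"
proof -
  have "f s \<in> {sqrt k, - sqrt k}" if "s \<in> I" for s
    using assms(3)[OF that] by (auto simp: abs_if split: if_splits)
  then have "finite (f ` I)"
    by (meson finite.emptyI finite.insertI finite_subset image_subsetI)
  then have "f constant_on I"
    using assms is_interval_connected continuous_finite_range_constant by blast
  with that show thesis
    unfolding constant_on_def by blast
qed

lemma induced_covariant_derivative_cong:
  fixes c :: "real \<Rightarrow> 'a::euclidean_space"
  assumes cov: "induced_covariant_derivative S TS nabla I c D" and I: "open I"
    and V: "field_along TS I c V" and TS: "\<And>s. s \<in> I \<Longrightarrow> 0 \<in> TS (c s)"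
    and eq: "\<And>s. s \<in> I \<Longrightarrow> V s = W s" and s: "s \<in> I"
  shows "D V s = D W s"
proof -
  define Z where "Z t = V t - W t" for t
  define f :: "real \<Rightarrow> real" where "f t = (if t \<in> I then 0 else 1)" for t
  have Z0: "Z t = 0" if "t \<in> I" for t
    using eq that by (simp add: Z_def)
  have W: "field_along TS I c W"
    using V smooth_on_cong[OF I eq] eq by (auto simp: field_along_def)
  have Z: "field_along TS I c Z"
    unfolding field_along_def
    using smooth_on_cong[OF I, of "\<lambda>_. 0" Z] Z0 TS by (auto simp: smooth_on_def Ck_on_const)
  have f: "smooth_on I f"
    by (rule smooth_on_cong[OF I, of "\<lambda>_. 0"]) (auto simp: smooth_on_def Ck_on_const f_def)
  have "D (\<lambda>t. f t *\<^sub>R Z t) s = velocity f s *\<^sub>R Z s + f s *\<^sub>R D Z s"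
    using cov f Z s unfolding induced_covariant_derivative_def by blast
  \<comment> \<open>Multiplying by the indicator of the complement of \<open>I\<close> does not change \<open>Z\<close>, so the Leibniz rule
    makes \<open>D Z\<close> vanish on \<open>I\<close>.\<close>
  moreover have "(\<lambda>t. f t *\<^sub>R Z t) = Z"
    using Z0 by (auto simp: f_def)
  ultimately have "D Z s = 0"
    using s Z0 by (simp add: f_def)
  moreover have "D (\<lambda>t. W t + Z t) s = D W s + D Z s"
    using cov W Z s unfolding induced_covariant_derivative_def by blast
  ultimately show ?thesis
    by (simp add: Z_def)
qed

lemma induced_covariant_derivative_vector_field:
  assumes "induced_covariant_derivative S TS nabla I c D"
    "vector_field S TS X" "vector_field S TS Y" "s \<in> I" "X (c s) = velocity c s"
  shows "D (\<lambda>t. Y (c t)) s = nabla X Y (c s)"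
proof -
  have "\<forall>X Y. vector_field S TS X \<longrightarrow> vector_field S TS Y \<longrightarrow>
        (\<forall>s\<in>I. X (c s) = velocity c s \<longrightarrow> D (\<lambda>t. Y (c t)) s = nabla X Y (c s))"
    using assms(1) unfolding induced_covariant_derivative_def by (elim conjE)
  from this[rule_format, OF assms(2-5)] show ?thesis .
qed

lemma bounded_bilinear_cross3: "bounded_bilinear cross3"
  using bilinear_cross bilinear_conv_bounded_bilinear by blast

lemmas bounded_linear_cross3_left = bounded_bilinear.bounded_linear_left[OF bounded_bilinear_cross3]
lemmas bounded_linear_cross3_right = bounded_bilinear.bounded_linear_right[OF bounded_bilinear_cross3]

text \<open>At points of the bundle the first field is the geodesic field \<open>u\<^sup>h\<close>. Writing \<open>- K x\<close> instead of
  the vertical part \<open>- x / (x \<bullet> x)\<close> of the lift makes the fields polynomial. The vector \<open>x \<times> u\<close> has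
  length \<open>1 / sqrt K\<close>.\<close>

definition frame_field :: "real \<Rightarrow> real \<Rightarrow> real \<Rightarrow> real \<Rightarrow> R3 \<times> R3 \<Rightarrow> R3 \<times> R3" where
  "frame_field K t1 t2 t3 p =
     (t1 *\<^sub>R snd p + t2 *\<^sub>R cross3 (fst p) (snd p),
      - (K * t1) *\<^sub>R fst p + t3 *\<^sub>R cross3 (fst p) (snd p))"

definition frame_field_deriv ::
  "real \<Rightarrow> real \<Rightarrow> real \<Rightarrow> real \<Rightarrow> R3 \<times> R3 \<Rightarrow> R3 \<times> R3 \<Rightarrow> R3 \<times> R3" where
  "frame_field_deriv K t1 t2 t3 p v =
     (t1 *\<^sub>R snd v + t2 *\<^sub>R (cross3 (fst p) (snd v) + cross3 (fst v) (snd p)),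
      - (K * t1) *\<^sub>R fst v + t3 *\<^sub>R (cross3 (fst p) (snd v) + cross3 (fst v) (snd p)))"

lemma has_derivative_frame_field:
  "(frame_field K t1 t2 t3 has_derivative frame_field_deriv K t1 t2 t3 p) (at p)"
  unfolding frame_field_def[abs_def] frame_field_deriv_def[abs_def]
  by (intro derivative_intros bounded_bilinear.FDERIV[OF bounded_bilinear_cross3])

lemma dir_deriv_frame_field:
  "dir_deriv (frame_field K t1 t2 t3) p v = frame_field_deriv K t1 t2 t3 p v"
  unfolding dir_deriv_def using frechet_derivative_at[OF has_derivative_frame_field] by metis

lemma smooth_on_frame_field: "smooth_on U (frame_field K t1 t2 t3)"
  unfolding smooth_on_def
proof
  fix k
  show "Ck_on k U (frame_field K t1 t2 t3)"
  proof (cases k)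
    case 0
    then show ?thesis
      using has_derivative_continuous[OF has_derivative_frame_field]
      by (simp add: continuous_at_imp_continuous_on)
  next
    case (Suc m)
    have "Ck_on m U (\<lambda>p. frame_field_deriv K t1 t2 t3 p v)" for v
    proof -
      have "bounded_linear (\<lambda>p. (t2 *\<^sub>R (cross3 (fst p) (snd v) + cross3 (fst v) (snd p)),
                            t3 *\<^sub>R (cross3 (fst p) (snd v) + cross3 (fst v) (snd p))))"
        by (intro bounded_linear_Pair bounded_linear_add
            bounded_linear_compose[OF bounded_linear_scaleR_right]
            bounded_linear_compose[OF bounded_linear_cross3_left]
            bounded_linear_compose[OF bounded_linear_cross3_right]
            bounded_linear_fst bounded_linear_snd)
      from Ck_on_affine[OF this, of m U "(t1 *\<^sub>R snd v, - (K * t1) *\<^sub>R fst v)"]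
      show ?thesis
        by (simp add: frame_field_deriv_def)
    qed
    then show ?thesis
      unfolding Suc by (auto intro!: exI[of _ "frame_field_deriv K t1 t2 t3"] has_derivative_frame_field)
  qed
qed

lemma inner_cross3_self:
  "cross3 x u \<bullet> cross3 x u = (x \<bullet> x) * (u \<bullet> u) - (x \<bullet> u)\<^sup>2"
  using norm_cross_dot[of x u] by (simp add: power_mult_distrib flip: power2_norm_eq_inner)

lemma unit_tangent_bundle_iff:
  assumes "K > 0"
  shows "(x, u) \<in> unit_tangent_bundle K \<longleftrightarrow> x \<bullet> x = 1 / K \<and> x \<bullet> u = 0 \<and> u \<bullet> u = 1"
proof -
  have "norm x = 1 / sqrt K \<longleftrightarrow> x \<bullet> x = 1 / K"
    using assms by (metis norm_eq_sqrt_inner real_sqrt_divide real_sqrt_eq_iff real_sqrt_one)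
  then show ?thesis
    by (auto simp: unit_tangent_bundle_def sphere_of_curvature_def sphere_tangent_def)
qed

lemma frame_field_tangent:
  assumes "K > 0" "p \<in> unit_tangent_bundle K"
  shows "frame_field K t1 t2 t3 p \<in> unit_tangent_space p"
  using assms
  by (cases p) (auto simp: unit_tangent_bundle_iff frame_field_def inner_add_left inner_add_right inner_diff_right
      dot_cross_self inner_commute)

lemma vector_field_frame_field:
  assumes "K > 0"
  shows "vector_field (unit_tangent_bundle K) unit_tangent_space (frame_field K t1 t2 t3)"
  unfolding vector_field_def smooth_near_def
  using smooth_on_frame_field[of UNIV] frame_field_tangent[OF assms] by blast

lemma orthogonal_to_sphere_point:
  assumes "K > 0" "(x, u) \<in> unit_tangent_bundle K" "x \<bullet> y = 0"
  shows "y = (y \<bullet> u) *\<^sub>R u + (K * (y \<bullet> cross3 x u)) *\<^sub>R cross3 x u"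
proof -
  have xu: "x \<bullet> x = 1 / K" "x \<bullet> u = 0" "u \<bullet> u = 1"
    using assms unit_tangent_bundle_iff by auto
  have "cross3 x (cross3 y u) = 0"
    using assms(3) xu by (simp add: Lagrange)
  then have "(x \<bullet> cross3 y u) *\<^sub>R x = (1 / K) *\<^sub>R cross3 y u"
    using Lagrange[of x x "cross3 y u"] xu by simp
  from arg_cong[OF this, of "scaleR K"]
  have "cross3 y u = (K * (x \<bullet> cross3 y u)) *\<^sub>R x"
    using \<open>K > 0\<close> by simp
  moreover have "x \<bullet> cross3 y u = - (y \<bullet> cross3 x u)"
    by (metis cross_skew cross_triple inner_commute inner_minus_right)
  ultimately have *: "cross3 y u = - (K * (y \<bullet> cross3 x u)) *\<^sub>R x"
    by simp
  have "y - (u \<bullet> y) *\<^sub>R u = cross3 u (cross3 y u)"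
    by (simp add: Lagrange xu)
  also have "\<dots> = (K * (y \<bullet> cross3 x u)) *\<^sub>R cross3 x u"
    unfolding * by (simp add: cross_mult_right cross_skew[of u x])
  finally show ?thesis
    by (simp add: algebra_simps inner_commute)
qed

lemma tangent_eq_frame_field:
  assumes "K > 0" "(x, u) \<in> unit_tangent_bundle K" "(y, w) \<in> unit_tangent_space (x, u)"
  shows "(y, w) = frame_field K (y \<bullet> u) (K * (y \<bullet> cross3 x u)) (K * (w \<bullet> cross3 x u)) (x, u)"
proof -
  have xu: "x \<bullet> x = 1 / K" "x \<bullet> u = 0" "u \<bullet> u = 1"
    using assms unit_tangent_bundle_iff by auto
  have yw: "x \<bullet> y = 0" "x \<bullet> w = - (y \<bullet> u)" "u \<bullet> w = 0"
    using assms(3) by auto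
  have "x \<bullet> (w + (K * (y \<bullet> u)) *\<^sub>R x) = 0"
    using xu yw \<open>K > 0\<close> by (simp add: inner_add_right)
  from orthogonal_to_sphere_point[OF assms(1,2) this]
  have "w + (K * (y \<bullet> u)) *\<^sub>R x = (K * (w \<bullet> cross3 x u)) *\<^sub>R cross3 x u"
    using xu yw by (simp add: inner_add_left dot_cross_self inner_commute[of w u])
  moreover have "y = (y \<bullet> u) *\<^sub>R u + (K * (y \<bullet> cross3 x u)) *\<^sub>R cross3 x u"
    by (rule orthogonal_to_sphere_point[OF assms(1,2) yw(1)])
  ultimately show ?thesis
    by (simp add: frame_field_def eq_diff_eq[symmetric])
qed

lemma g1_frame_field:
  assumes "x \<noteq> 0"
  shows "g1 c1 c2 d1 l (x, u) (frame_field K s1 s2 s3 (x, u)) (frame_field K t1 t2 t3 (x, u)) =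
    nd_alpha c1 d1 l * (c1 * (s1 * t1 * (u \<bullet> u) + s2 * t2 * ((x \<bullet> x) * (u \<bullet> u) - (x \<bullet> u)\<^sup>2))
      + d1 * (s1 * t1) * (u \<bullet> u)\<^sup>2 + c2 * (s3 * t3) * ((x \<bullet> x) * (u \<bullet> u) - (x \<bullet> u)\<^sup>2))"
proof -
  have t: "tpart (x, u) (frame_field K a b c (x, u)) = c *\<^sub>R cross3 x u" for a b c
    using assms by (simp add: tpart_def tang_proj_def frame_field_def inner_diff_right dot_cross_self)
  have h: "hpart (x, u) (frame_field K a b c (x, u)) = a *\<^sub>R u + b *\<^sub>R cross3 x u" for a b c
    by (simp add: hpart_def frame_field_def)
  show ?thesis
    unfolding g1_def g1d_def t h
    by (simp add: inner_add_left inner_add_right dot_cross_self inner_commute[of u "cross3 x u"]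
        inner_cross3_self power2_eq_square algebra_simps)
qed

lemma dir_deriv_g1_frame_field:
  assumes "K > 0" "p \<in> unit_tangent_bundle K" "v \<in> unit_tangent_space p"
  shows "dir_deriv (\<lambda>q. g1 c1 c2 d1 l q (frame_field K s1 s2 s3 q) (frame_field K t1 t2 t3 q)) p v = 0"
proof -
  obtain x u where p: "p = (x, u)" by (cases p)
  obtain y w where v: "v = (y, w)" by (cases v)
  have xu: "x \<bullet> x = 1 / K" "x \<bullet> u = 0" "u \<bullet> u = 1"
    using assms unit_tangent_bundle_iff p by auto
  have yw: "x \<bullet> y = 0" "y \<bullet> u + x \<bullet> w = 0" "u \<bullet> w = 0" "w \<bullet> u = 0" "y \<bullet> x = 0"
    using assms(3) by (auto simp: p v inner_commute)
  \<comment> \<open>Off \<open>x = 0\<close> the inner product is a polynomial in \<open>x \<bullet> x\<close>, \<open>x \<bullet> u\<close> and \<open>u \<bullet> u\<close>, the functions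
    defining the bundle.\<close>
  define F :: "real \<Rightarrow> real \<Rightarrow> real \<Rightarrow> real" where
    "F a b e = nd_alpha c1 d1 l * (c1 * (s1 * t1 * e + s2 * t2 * (a * e - b\<^sup>2))
      + d1 * (s1 * t1) * e\<^sup>2 + c2 * (s3 * t3) * (a * e - b\<^sup>2))" for a b e
  define G where "G q = F (fst q \<bullet> fst q) (fst q \<bullet> snd q) (snd q \<bullet> snd q)" for q :: "R3 \<times> R3"
  have "\<exists>G'. (G has_derivative G') (at p) \<and> G' v = 0"
    unfolding G_def[abs_def] F_def
    apply (rule exI, rule conjI)
     apply (rule derivative_eq_intros refl)+
    using yw by (simp add: p v xu inner_commute algebra_simps)
  then obtain G' where G': "(G has_derivative G') (at p)" "G' v = 0" by blast
  have "open (fst -` (- {0}) :: (R3 \<times> R3) set)"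
    by (intro open_vimage_fst) auto
  moreover have "p \<in> fst -` (- {0})"
    using xu(1) \<open>K > 0\<close> by (auto simp: p)
  ultimately have "((\<lambda>q. g1 c1 c2 d1 l q (frame_field K s1 s2 s3 q) (frame_field K t1 t2 t3 q))
      has_derivative G') (at p)"
    by (rule has_derivative_transform_within_open[OF G'(1)])
      (auto simp: G_def F_def g1_frame_field)
  then show ?thesis
    unfolding dir_deriv_def using frechet_derivative_at G'(2) by metis
qed

lemma lie_bracket_frame_field:
  "lie_bracket (frame_field K t1 t2 t3) (frame_field K 1 0 0) p
    = frame_field K 0 t3 (- K * t2) p"
proof -
  obtain x u where p: "p = (x, u)" by (cases p)
  show ?thesis
    unfolding lie_bracket_def dir_deriv_frame_field
    by (simp add: p frame_field_def frame_field_deriv_def cross_mult_right algebra_simps)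
qed

lemma g1_add_right:
  "g1 c1 c2 d1 l p v (w + w') = g1 c1 c2 d1 l p v w + g1 c1 c2 d1 l p v w'"
  by (simp add: g1_def g1d_def hpart_def tpart_def tang_proj_def inner_add_right inner_add_left
      inner_diff_right inner_diff_left add_divide_distrib algebra_simps)

lemma g1_scaleR:
  "g1 c1 c2 d1 l p (a *\<^sub>R v) w = a * g1 c1 c2 d1 l p v w"
  "g1 c1 c2 d1 l p v (a *\<^sub>R w) = a * g1 c1 c2 d1 l p v w"
  by (simp_all add: g1_def g1d_def hpart_def tpart_def tang_proj_def 
      inner_diff_right inner_diff_left algebra_simps)

lemma g1_commute: "g1 c1 c2 d1 l p v w = g1 c1 c2 d1 l p w v"
  by (simp add: g1_def g1d_def inner_commute mult.commute mult.left_commute)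

lemma levi_civita_torsion_free:
  assumes "levi_civita S TS g nabla" "vector_field S TS X" "vector_field S TS Y" "p \<in> S"
  shows "nabla X Y p - nabla Y X p = lie_bracket X Y p"
  using assms unfolding levi_civita_def by blast

lemma levi_civita_metric:
  assumes "levi_civita S TS g nabla" "vector_field S TS X" "vector_field S TS Y"
    "vector_field S TS Z" "p \<in> S"
  shows "g p (nabla X Y p) (Z p) + g p (Y p) (nabla X Z p)
    = dir_deriv (\<lambda>q. g q (Y q) (Z q)) p (X p)"
proof -
  have "\<forall>X Y Z. vector_field S TS X \<longrightarrow> vector_field S TS Y \<longrightarrow> vector_field S TS Z \<longrightarrow>
        (\<forall>p\<in>S. dir_deriv (\<lambda>q. g q (Y q) (Z q)) p (X p)
               = g p (nabla X Y p) (Z p) + g p (Y p) (nabla X Z p))"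
    using assms(1) unfolding levi_civita_def by (elim conjE)
  from this[rule_format, OF assms(2-5)] show ?thesis by simp
qed

lemma g1_covariant_derivative_geodesic_field:
  fixes t1 t2 t3 :: real
  assumes K: "K > 0" and lc: "levi_civita (unit_tangent_bundle K) unit_tangent_space (g1 c1 c2 d1 l) nabla"
    and p: "p \<in> unit_tangent_bundle K"
  defines "W \<equiv> frame_field K t1 t2 t3" and "E \<equiv> frame_field K 1 0 0"
  shows "g1 c1 c2 d1 l p (nabla W W p) (E p) = nd_alpha c1 d1 l * t2 * t3 * (K * c2 - c1) / K"
proof -
  let ?g = "g1 c1 c2 d1 l p"
  have vf: "vector_field (unit_tangent_bundle K) unit_tangent_space W"
    "vector_field (unit_tangent_bundle K) unit_tangent_space E"
    unfolding W_def E_def by (rule vector_field_frame_field[OF K])+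
  have tan: "W p \<in> unit_tangent_space p" "E p \<in> unit_tangent_space p"
    unfolding W_def E_def by (rule frame_field_tangent[OF K p])+
  have "?g (nabla W W p) (E p) + ?g (W p) (nabla W E p)
      = dir_deriv (\<lambda>q. g1 c1 c2 d1 l q (W q) (E q)) p (W p)"
    by (rule levi_civita_metric[OF lc vf(1,1,2) p])
  also have "\<dots> = 0"
    unfolding W_def E_def by (rule dir_deriv_g1_frame_field[OF K p tan(1)[unfolded W_def]])
  finally have 1: "?g (nabla W W p) (E p) = - ?g (W p) (nabla W E p)" by simp
  have "?g (nabla E W p) (W p) + ?g (W p) (nabla E W p)
      = dir_deriv (\<lambda>q. g1 c1 c2 d1 l q (W q) (W q)) p (E p)"
    by (rule levi_civita_metric[OF lc vf(2,1,1) p])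
  also have "\<dots> = 0"
    unfolding W_def by (rule dir_deriv_g1_frame_field[OF K p tan(2)])
  finally have 2: "?g (W p) (nabla E W p) = 0"
    using g1_commute[of c1 c2 d1 l p "W p"] by simp
  have "nabla W E p - nabla E W p = frame_field K 0 t3 (- K * t2) p"
    unfolding levi_civita_torsion_free[OF lc vf p] unfolding W_def E_def
    by (rule lie_bracket_frame_field)
  then have "nabla W E p = nabla E W p + frame_field K 0 t3 (- K * t2) p"
    by (simp add: algebra_simps)
  then have 3: "?g (nabla W W p) (E p) = - ?g (W p) (frame_field K 0 t3 (- K * t2) p)"
    using 1 2 by (simp add: g1_add_right)
  obtain x u where xu: "p = (x, u)" by (cases p)
  with K p have "x \<bullet> x = 1 / K" "x \<bullet> u = 0" "u \<bullet> u = 1"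
    using unit_tangent_bundle_iff by auto
  moreover from this have "x \<noteq> 0"
    using K by auto
  ultimately show ?thesis
    unfolding 3 unfolding W_def xu using K by (simp add: g1_frame_field diff_divide_distrib algebra_simps)
qed

lemma xi1_eq_frame_field:
  assumes "K > 0" "p \<in> unit_tangent_bundle K"
  shows "xi1 c1 d1 l p = (1 / (2 * l * nd_alpha c1 d1 l)) *\<^sub>R frame_field K 1 0 0 p"
  using assms by (cases p) (simp add: xi1_def frame_field_def unit_tangent_bundle_iff)

lemma velocity_in_unit_tangent_space:
  assumes K: "K > 0" and I: "open I" and c: "smooth_on I c" "\<And>s. s \<in> I \<Longrightarrow> c s \<in> unit_tangent_bundle K"
    and s: "s \<in> I"
  shows "velocity c s \<in> unit_tangent_space (c s)"
proof -
  have d: "(c has_vector_derivative velocity c s) (at s)"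
    using smooth_on_has_vector_derivative c s by blast
  define x u y w where "x = (\<lambda>s. fst (c s))" "u = (\<lambda>s. snd (c s))"
    and "y = fst (velocity c s)" "w = snd (velocity c s)"
  note defs = this
  have x: "(x has_vector_derivative y) (at s)" and u: "(u has_vector_derivative w) (at s)"
    unfolding defs
    using bounded_linear.has_vector_derivative[OF bounded_linear_fst d]
      bounded_linear.has_vector_derivative[OF bounded_linear_snd d] by auto
  have const: "x t \<bullet> x t = 1 / K" "x t \<bullet> u t = 0" "u t \<bullet> u t = 1" if "t \<in> I" for t
    using c(2)[OF that] unit_tangent_bundle_iff[OF K, of "x t" "u t"] by (auto simp: defs)
  have zero: "a \<bullet> b' + a' \<bullet> b = 0"
    if "(f has_vector_derivative a') (at s)" "(h has_vector_derivative b') (at s)"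
      "a = f s" "b = h s" "\<And>t. t \<in> I \<Longrightarrow> f t \<bullet> h t = k"
    for f h :: "real \<Rightarrow> R3" and a b a' b' and k :: real
  proof -
    have "((\<lambda>t. f t \<bullet> h t) has_vector_derivative a \<bullet> b' + a' \<bullet> b) (at s)"
      using bounded_bilinear.has_vector_derivative[OF bounded_bilinear_inner that(1,2)] that(3,4) by simp
    moreover have "((\<lambda>t. f t \<bullet> h t) has_vector_derivative 0) (at s)"
      by (rule has_vector_derivative_transform_within_open[OF _ I s, of "\<lambda>_. k"]) (auto simp: that(5))
    ultimately show ?thesis
      using vector_derivative_unique_at by blast
  qed
  have "x s \<bullet> y = 0" "y \<bullet> u s + x s \<bullet> w = 0" "u s \<bullet> w = 0"
    using zero[OF x x refl refl const(1)] zero[OF x u refl refl const(2)]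
      zero[OF u u refl refl const(3)] by (auto simp: inner_commute)
  moreover have "c s = (x s, u s)" "velocity c s = (y, w)"
    by (simp_all add: defs)
  ultimately show ?thesis by simp
qed

lemma sphere_frenet_integral_curve:
  assumes K: "K > 0" and I: "open I" and s: "s \<in> I"
    and c: "smooth_on I (\<lambda>s. (\<gamma> s, X s))" "\<And>s. s \<in> I \<Longrightarrow> (\<gamma> s, X s) \<in> unit_tangent_bundle K"
    and vel: "\<And>s. s \<in> I \<Longrightarrow> velocity (\<lambda>s. (\<gamma> s, X s)) s = frame_field K t1 t2 t3 (\<gamma> s, X s)"
    and speed: "\<And>s. s \<in> I \<Longrightarrow> speed \<gamma> s = r" and r: "r > 0"
    and frenet: "sphere_frenet I \<gamma> N \<kappa>"
  shows "\<kappa> s = t3 / r\<^sup>2 * (N s \<bullet> (t1 *\<^sub>R cross3 (\<gamma> s) (X s) - (t2 / K) *\<^sub>R X s))"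
    and "(\<kappa> s)\<^sup>2 = t3\<^sup>2 / (K * r\<^sup>2)"
proof -
  define A where "A = t1 *\<^sub>R cross3 (\<gamma> s) (X s) - (t2 / K) *\<^sub>R X s"
  let ?W = "frame_field K t1 t2 t3"
  have d: "((\<lambda>s. (\<gamma> s, X s)) has_vector_derivative ?W (\<gamma> t, X t)) (at t)" if "t \<in> I" for t
    using smooth_on_has_vector_derivative[OF c(1) that] vel[OF that] by simp
  have d\<gamma>: "(\<gamma> has_vector_derivative fst (?W (\<gamma> t, X t))) (at t)" if "t \<in> I" for t
    using bounded_linear.has_vector_derivative[OF bounded_linear_fst d[OF that]] by simp
  have vel\<gamma>: "velocity \<gamma> t = fst (?W (\<gamma> t, X t))" if "t \<in> I" for t
    using d\<gamma>[OF that] by (simp add: velocity_def vector_derivative_at)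
  have T: "unit_tangent \<gamma> t = (1 / r) *\<^sub>R fst (?W (\<gamma> t, X t))" if "t \<in> I" for t
    using vel\<gamma>[OF that] speed[OF that] by (simp add: unit_tangent_def inverse_eq_divide)
  have "((\<lambda>t. ?W (\<gamma> t, X t)) has_vector_derivative
      frame_field_deriv K t1 t2 t3 (\<gamma> s, X s) (?W (\<gamma> s, X s))) (at s)"
    using vector_derivative_diff_chain_within[OF d[OF s] has_derivative_at_withinI[OF has_derivative_frame_field]]
    by (simp add: o_def)
  from bounded_linear.has_vector_derivative[OF
      bounded_linear_compose[OF bounded_linear_scaleR_right bounded_linear_fst] this]
  have "((\<lambda>t. (1 / r) *\<^sub>R fst (?W (\<gamma> t, X t))) has_vector_derivative
      (1 / r) *\<^sub>R fst (frame_field_deriv K t1 t2 t3 (\<gamma> s, X s) (?W (\<gamma> s, X s)))) (at s)" .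
  then have "(unit_tangent \<gamma> has_vector_derivative
      (1 / r) *\<^sub>R fst (frame_field_deriv K t1 t2 t3 (\<gamma> s, X s) (?W (\<gamma> s, X s)))) (at s)"
    by (rule has_vector_derivative_transform_within_open[OF _ I s]) (simp add: T)
  then have vT: "velocity (unit_tangent \<gamma>) s
      = (1 / r) *\<^sub>R fst (frame_field_deriv K t1 t2 t3 (\<gamma> s, X s) (?W (\<gamma> s, X s)))"
    by (simp add: velocity_def vector_derivative_at)
  have p: "\<gamma> s \<bullet> \<gamma> s = 1 / K" "\<gamma> s \<bullet> X s = 0" "X s \<bullet> \<gamma> s = 0" "X s \<bullet> X s = 1"
    using c(2)[OF s] K unit_tangent_bundle_iff by (auto simp: inner_commute)
  have "cross3 (cross3 (\<gamma> s) (X s)) (X s) = - \<gamma> s"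
    using cross_skew[of "cross3 (\<gamma> s) (X s)" "X s"] by (simp add: Lagrange p)
  then have yu: "cross3 (fst (?W (\<gamma> s, X s))) (X s) = - t2 *\<^sub>R \<gamma> s"
    by (simp add: frame_field_def cross_add_left cross_mult_left)
  have "cross3 (\<gamma> s) (cross3 (\<gamma> s) (X s)) = - (1 / K) *\<^sub>R X s"
    by (simp add: Lagrange p)
  then have xw: "cross3 (\<gamma> s) (snd (?W (\<gamma> s, X s))) = - (t3 / K) *\<^sub>R X s"
    by (simp add: frame_field_def Cross3.right_diff_distrib cross_mult_right)
  have "fst (frame_field_deriv K t1 t2 t3 (\<gamma> s, X s) (?W (\<gamma> s, X s)))
      = t1 *\<^sub>R snd (?W (\<gamma> s, X s)) + t2 *\<^sub>R (- (t3 / K) *\<^sub>R X s + - t2 *\<^sub>R \<gamma> s)"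
    using xw yu by (simp add: frame_field_deriv_def)
  also have "\<dots> = (- (K * t1\<^sup>2 + t2\<^sup>2)) *\<^sub>R \<gamma> s + t3 *\<^sub>R A"
    by (simp add: A_def frame_field_def power2_eq_square algebra_simps)
  finally have acc: "velocity (unit_tangent \<gamma>) s
      = (- (K * t1\<^sup>2 + t2\<^sup>2) / r) *\<^sub>R \<gamma> s + (t3 / r) *\<^sub>R A"
    by (simp add: vT scaleR_add_right)
  have "\<gamma> s \<bullet> A = 0"
    by (simp add: A_def inner_diff_right dot_cross_self p)
  then have cov: "sphere_cov \<gamma> (unit_tangent \<gamma>) s = (t3 / r) *\<^sub>R A"
    unfolding sphere_cov_def acc tang_proj_def using K by (simp add: p inner_add_right)
  have rN: "(r * \<kappa> s) *\<^sub>R N s = (t3 / r) *\<^sub>R A" and N: "N s \<bullet> N s = 1"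
    using frenet s speed[OF s] cov by (auto simp: sphere_frenet_def norm_eq_1)
  have "r * \<kappa> s = N s \<bullet> ((r * \<kappa> s) *\<^sub>R N s)"
    by (simp add: N)
  then have "r * \<kappa> s = t3 / r * (N s \<bullet> A)"
    unfolding rN by simp
  then show "\<kappa> s = t3 / r\<^sup>2 * (N s \<bullet> (t1 *\<^sub>R cross3 (\<gamma> s) (X s) - (t2 / K) *\<^sub>R X s))"
    unfolding A_def using r by (simp add: field_simps power2_eq_square)
  have "r\<^sup>2 = fst (?W (\<gamma> s, X s)) \<bullet> fst (?W (\<gamma> s, X s))"
    using speed[OF s] vel\<gamma>[OF s] by (metis speed_def power2_norm_eq_inner)
  also have "\<dots> = t1\<^sup>2 + t2\<^sup>2 / K"
    by (simp add: frame_field_def inner_add_left inner_add_right dot_cross_self inner_cross3_self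
        inner_commute[of "X s" "cross3 (\<gamma> s) (X s)"] p power2_eq_square)
  finally have r2: "r\<^sup>2 = t1\<^sup>2 + t2\<^sup>2 / K" .
  have "A \<bullet> A = r\<^sup>2 / K"
    unfolding A_def r2
    by (simp add: inner_diff_left inner_diff_right dot_cross_self inner_cross3_self
        inner_commute[of "X s" "cross3 (\<gamma> s) (X s)"] p power2_eq_square add_divide_distrib)
  moreover have "(r * \<kappa> s)\<^sup>2 = (t3 / r)\<^sup>2 * (A \<bullet> A)"
    using arg_cong[OF rN, of "\<lambda>z. z \<bullet> z"] N by (simp add: power2_eq_square)
  ultimately have "(r * \<kappa> s)\<^sup>2 = t3\<^sup>2 / K"
    using r by (simp add: power_divide)
  then show "(\<kappa> s)\<^sup>2 = t3\<^sup>2 / (K * r\<^sup>2)"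
    using r K by (simp add: field_simps)
qed

lemma nonzero_constant_on_quotient_iff:
  assumes "I \<noteq> {}" "a = 0 \<longleftrightarrow> b = 0"
  shows "nonzero_constant_on I (\<lambda>s. a / f s) \<longleftrightarrow> nonzero_constant_on I (\<lambda>s. b / f s)"
proof -
  have "nonzero_constant_on I (\<lambda>s. b / f s)"
    if nc: "nonzero_constant_on I (\<lambda>s. a / f s)" and ab: "a = 0 \<longleftrightarrow> b = 0" for a b
  proof -
    obtain k where k: "k \<noteq> 0" "\<And>s. s \<in> I \<Longrightarrow> a / f s = k"
      using nc unfolding nonzero_constant_on_def by blast
    with assms(1) have "a \<noteq> 0" by force
    with ab have "b \<noteq> 0" by blast
    have "b / f s = b / a * k" if "s \<in> I" for s
      using k(2)[OF that] \<open>a \<noteq> 0\<close> by (auto simp: field_simps)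
    with k(1) \<open>a \<noteq> 0\<close> \<open>b \<noteq> 0\<close> show ?thesis
      unfolding nonzero_constant_on_def by (intro exI[of _ "b / a * k"]) auto
  qed
  with assms(2) show ?thesis by blast
qed

theorem proposition4:
  fixes K c1 c2 d1 l a1 a2 r0 :: real
    and I :: "real set"
    and \<gamma> X N :: "real \<Rightarrow> R3"
    and \<kappa> :: "real \<Rightarrow> real"
    and nabla :: "(R3 \<times> R3 \<Rightarrow> R3 \<times> R3) \<Rightarrow> (R3 \<times> R3 \<Rightarrow> R3 \<times> R3) \<Rightarrow>
                  R3 \<times> R3 \<Rightarrow> R3 \<times> R3"
    and D :: "(real \<Rightarrow> R3 \<times> R3) \<Rightarrow> real \<Rightarrow> R3 \<times> R3"
  defines "M1 \<equiv> unit_tangent_bundle K"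
    and "g \<equiv> g1 c1 c2 d1 l"
    and "\<xi> \<equiv> xi1 c1 d1 l"
    and "c \<equiv> (\<lambda>s. (\<gamma> s, X s))"
  assumes K: "K > 0" "K \<noteq> 1"
    and constants: "c1 > 0" "c2 > 0" "c1 + d1 > 0" "l \<noteq> 0" "a1 \<noteq> 0" "a2 = 1 / a1"
    and contact: "contact_metric_structure M1 unit_tangent_space
                    (phi1 a1 a2) \<xi> (eta1 c1 d1 l) g"
    and c2: "c2 = c1 + d1"
    and connection: "levi_civita M1 unit_tangent_space g nabla"
    and interval: "open I" "is_interval I" "I \<noteq> {}"
    and curve: "smooth_on I c" "\<forall>s\<in>I. c s \<in> M1"
    and covariant: "induced_covariant_derivative M1 unit_tangent_space nabla I c D"
    and arc_length: "\<forall>s\<in>I. g (c s) (velocity c s) (velocity c s) = 1"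
    and curvature: "\<forall>s\<in>I. frenet_curvature g D c s \<noteq> 0"
    and slant: "nonzero_constant_on I (\<lambda>s. g (c s) (velocity c s) (\<xi> (c s)))"
    and constant_speed: "\<forall>s\<in>I. speed \<gamma> s = r0"
    and frenet: "sphere_frenet I \<gamma> N \<kappa>"
    \<comment> \<open>If \<open>K * c2 = c1\<close> (\<open>\<xi>\<close> is Killing) or \<open>X\<close> is parallel to the velocity of \<open>\<gamma>\<close>, then \<open>\<xi>\<close> is
      orthogonal to the principal normal, but the ratio below can be a nonzero constant.\<close>
    and not_Killing: "K * c2 \<noteq> c1"
    and not_natural_lift: "\<exists>s\<in>I. velocity \<gamma> s \<notin> span {X s}"
  shows "nonzero_constant_on I (\<lambda>s. g (c s) (principal_normal g D c s) (\<xi> (c s))) \<longleftrightarrow>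
         nonzero_constant_on I (\<lambda>s. (K - 1) * \<kappa> s / frenet_curvature g D c s)"
proof -
  define al where "al = nd_alpha c1 d1 l"
  have al: "al > 0"
    using constants by (simp add: al_def nd_alpha_def)
  define k where "k = 1 / (2 * l * al)"
  have k: "k \<noteq> 0"
    using al constants by (simp add: k_def)
  have g_def': "g = g1 c1 c2 d1 l"
    by (simp add: g_def)
  have M: "(\<gamma> s, X s) \<in> unit_tangent_bundle K" if "s \<in> I" for s
    using curve(2) that by (simp add: c_def M1_def)
  have p: "\<gamma> s \<bullet> \<gamma> s = 1 / K" "\<gamma> s \<bullet> X s = 0" "X s \<bullet> \<gamma> s = 0" "X s \<bullet> X s = 1" "\<gamma> s \<noteq> 0" if "s \<in> I" for s
    using M[OF that] K unit_tangent_bundle_iff by (auto simp: inner_commute)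
  have xi: "\<xi> (c s) = k *\<^sub>R frame_field K 1 0 0 (c s)" if "s \<in> I" for s
    using xi1_eq_frame_field[OF K(1) M[OF that]] by (simp add: \<xi>_def k_def al_def c_def)
  define n where "n s = cross3 (\<gamma> s) (X s)" for s
  define f1 where "f1 s = fst (velocity c s) \<bullet> X s" for s
  define f2 where "f2 s = K * (fst (velocity c s) \<bullet> n s)" for s
  define f3 where "f3 s = K * (snd (velocity c s) \<bullet> n s)" for s
  have vel: "velocity c s = frame_field K (f1 s) (f2 s) (f3 s) (c s)" if "s \<in> I" for s
  proof -
    have "velocity c s \<in> unit_tangent_space (c s)"
      using velocity_in_unit_tangent_space[OF K(1) interval(1) curve(1) _ that] M by (simp add: c_def)
    then show ?thesis
      using tangent_eq_frame_field[OF K(1) M[OF that], of "fst (velocity c s)" "snd (velocity c s)"]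
      by (simp add: c_def f1_def f2_def f3_def n_def)
  qed
  have gW: "g (c s) (frame_field K s1 s2 s3 (c s)) (frame_field K t1 t2 t3 (c s))
      = al * ((c1 + d1) * (s1 * t1) + (c1 * (s2 * t2) + c2 * (s3 * t3)) / K)"
    if "s \<in> I" for s s1 s2 s3 t1 t2 t3
    by (simp add: g_def c_def al_def g1_frame_field p[OF that] algebra_simps add_divide_distrib)
  have cont: "continuous_on I (velocity c)" "continuous_on I c"
    using smooth_on_continuous smooth_on_velocity[OF interval(1) curve(1)] curve(1) by auto
  have cont': "continuous_on I \<gamma>" "continuous_on I X"
    using continuous_on_fst[OF cont(2)] continuous_on_snd[OF cont(2)] by (simp_all add: c_def)
  obtain e where e: "e \<noteq> 0" "\<And>s. s \<in> I \<Longrightarrow> g (c s) (velocity c s) (\<xi> (c s)) = e"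
    using slant unfolding nonzero_constant_on_def by blast
  define t1 where "t1 = e / (k * al * (c1 + d1))"
  have t1: "f1 s = t1" if "s \<in> I" for s
  proof -
    have "k * al * (c1 + d1) * f1 s = e"
      using e(2)[OF that] gW[OF that, unfolded g_def']
      by (simp add: vel[OF that] xi[OF that] g_def' g1_scaleR mult.assoc)
    moreover have "k * al * (c1 + d1) \<noteq> 0"
      using constants al k by simp
    ultimately show ?thesis
      unfolding t1_def by (metis nonzero_mult_div_cancel_left)
  qed
  have t1_nz: "t1 \<noteq> 0"
    using e(1) constants al k by (simp add: t1_def)
  have vel\<gamma>: "velocity \<gamma> s = fst (velocity c s)" if "s \<in> I" for s
    using bounded_linear.has_vector_derivative[OF bounded_linear_fst
        smooth_on_has_vector_derivative[OF curve(1) that]]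
    by (simp add: c_def velocity_def vector_derivative_at)
  have r0_sq: "r0\<^sup>2 = t1\<^sup>2 + (f2 s)\<^sup>2 / K" if "s \<in> I" for s
  proof -
    have "r0\<^sup>2 = velocity \<gamma> s \<bullet> velocity \<gamma> s"
      using constant_speed that by (metis speed_def power2_norm_eq_inner)
    also have "\<dots> = t1\<^sup>2 + (f2 s)\<^sup>2 / K"
      unfolding vel\<gamma>[OF that] vel[OF that] t1[OF that]
      by (simp add: c_def frame_field_def inner_add_left inner_add_right dot_cross_self
          inner_cross3_self inner_commute[of "X s" "cross3 (\<gamma> s) (X s)"] p[OF that] power2_eq_square)
    finally show ?thesis .
  qed
  have "(f2 s)\<^sup>2 = K * (r0\<^sup>2 - t1\<^sup>2)" if "s \<in> I" for s
    using r0_sq[OF that] K by simp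
  moreover have "continuous_on I f2" "continuous_on I f3"
    unfolding f2_def f3_def n_def
    by (intro continuous_intros continuous_on_cross cont cont')+
  ultimately obtain t2 where t2: "\<And>s. s \<in> I \<Longrightarrow> f2 s = t2"
    using constant_if_square_constant[OF interval(2)] by metis
  have "(f3 s)\<^sup>2 = (K * (1 / al - (c1 + d1) * t1\<^sup>2) - c1 * t2\<^sup>2) / c2" if "s \<in> I" for s
  proof -
    have "al * ((c1 + d1) * t1\<^sup>2 + (c1 * t2\<^sup>2 + c2 * (f3 s)\<^sup>2) / K) = 1"
      using arc_length[rule_format, OF that]
      unfolding vel[OF that] t1[OF that] t2[OF that] gW[OF that] by (simp add: power2_eq_square)
    then show ?thesis
      using al constants K by (simp add: field_simps)
  qed
  with \<open>continuous_on I f3\<close> obtain t3 where t3: "\<And>s. s \<in> I \<Longrightarrow> f3 s = t3"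
    using constant_if_square_constant[OF interval(2)] by metis
  define W where "W = frame_field K t1 t2 t3"
  have velW: "velocity c s = W (c s)" if "s \<in> I" for s
    using vel t1 t2 t3 that by (simp add: W_def)
  have t2_nz: "t2 \<noteq> 0"
  proof
    assume "t2 = 0"
    then have "velocity \<gamma> s = t1 *\<^sub>R X s" if "s \<in> I" for s
      unfolding vel\<gamma>[OF that] velW[OF that] by (simp add: W_def frame_field_def c_def)
    then show False
      using not_natural_lift by (metis span_base span_scale singletonI)
  qed
  have vfW: "vector_field M1 unit_tangent_space W"
    unfolding W_def M1_def by (rule vector_field_frame_field[OF K(1)])
  have zero: "0 \<in> unit_tangent_space q" for q
    by (cases q) (simp add: zero_prod_def)
  have fa: "field_along unit_tangent_space I c (velocity c)"
    unfolding field_along_def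
    using smooth_on_velocity[OF interval(1) curve(1)] velW vfW curve(2) by (simp add: vector_field_def)
  have acc: "D (velocity c) s = nabla W W (c s)" if "s \<in> I" for s
  proof -
    have "D (velocity c) s = D (\<lambda>t. W (c t)) s"
      by (rule induced_covariant_derivative_cong[OF covariant interval(1) fa zero velW that])
    also have "\<dots> = nabla W W (c s)"
      by (rule induced_covariant_derivative_vector_field[OF covariant vfW vfW that])
        (simp add: velW[OF that])
    finally show ?thesis .
  qed
  define C where "C = k * (al * t2 * t3 * (K * c2 - c1) / K)"
  have normal: "g (c s) (principal_normal g D c s) (\<xi> (c s)) = C / frenet_curvature g D c s"
    if "s \<in> I" for s
  proof -
    have "g (c s) (D (velocity c) s) (\<xi> (c s)) = C"
      unfolding acc[OF that] xi[OF that] g_def' g1_scaleR C_def W_def al_def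
      using g1_covariant_derivative_geodesic_field[OF K(1) connection[unfolded g_def M1_def]]
        M[OF that] by (simp add: c_def)
    then show ?thesis
      unfolding principal_normal_def by (simp add: g_def' g1_scaleR divide_inverse mult.commute)
  qed
  obtain s0 where s0: "s0 \<in> I"
    using interval(3) by blast
  have "r0\<^sup>2 > 0"
    using r0_sq[OF s0] t1_nz K by (simp add: add_pos_nonneg)
  moreover have "r0 \<ge> 0"
    using constant_speed s0 by (metis norm_ge_zero speed_def)
  ultimately have r0: "r0 > 0"
    by (simp add: less_le)
  have \<kappa>: "\<kappa> s = t3 / r0\<^sup>2 * (N s \<bullet> (t1 *\<^sub>R cross3 (\<gamma> s) (X s) - (t2 / K) *\<^sub>R X s))"
    "(\<kappa> s)\<^sup>2 = t3\<^sup>2 / (K * r0\<^sup>2)" if "s \<in> I" for s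
    by (rule sphere_frenet_integral_curve[OF K(1) interval(1) that curve(1)[unfolded c_def] M
      velW[unfolded c_def W_def] constant_speed[rule_format] r0 frenet]; assumption)+
  have "continuous_on I N"
    using frenet smooth_on_continuous by (auto simp: sphere_frenet_def)
  then have "continuous_on I (\<lambda>s. t3 / r0\<^sup>2 * (N s \<bullet> (t1 *\<^sub>R cross3 (\<gamma> s) (X s) - (t2 / K) *\<^sub>R X s)))"
    by (intro continuous_intros continuous_on_cross cont')
  then have "continuous_on I \<kappa>"
    by (rule continuous_on_eq) (rule \<kappa>(1)[symmetric])
  then obtain b where b: "\<And>s. s \<in> I \<Longrightarrow> \<kappa> s = b"
    by (rule constant_if_square_constant[OF interval(2)]) (use \<kappa>(2) in blast)+
  have "b\<^sup>2 = t3\<^sup>2 / (K * r0\<^sup>2)"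
    using \<kappa>(2)[OF s0] b[OF s0] by simp
  then have "b = 0 \<longleftrightarrow> t3 = 0"
    using K r0 by auto
  then have C: "C = 0 \<longleftrightarrow> (K - 1) * b = 0"
    using k al t2_nz not_Killing K by (simp add: C_def)
  have "nonzero_constant_on I (\<lambda>s. g (c s) (principal_normal g D c s) (\<xi> (c s)))
      \<longleftrightarrow> nonzero_constant_on I (\<lambda>s. C / frenet_curvature g D c s)"
    by (simp add: nonzero_constant_on_def normal)
  also have "\<dots> \<longleftrightarrow> nonzero_constant_on I (\<lambda>s. (K - 1) * b / frenet_curvature g D c s)"
    by (rule nonzero_constant_on_quotient_iff[OF interval(3) C])
  also have "\<dots> \<longleftrightarrow> nonzero_constant_on I (\<lambda>s. (K - 1) * \<kappa> s / frenet_curvature g D c s)"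
    by (simp add: nonzero_constant_on_def b)
  finally show ?thesis .
qed

end
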